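(* There is a dynamic algorithm that maintains a maximal clique of a decremental graph $G$ with maximum degree $\Delta$ in $O(\Delta)$ amortized update time against an adaptive adversary.
   Context: All graphs are undirected and unweighted. A decremental graph undergoes a sequence of edge deletions; after each update the algorithm must output a maximal clique (a clique not contained in a larger clique) of the current graph. $\Delta$ is the maximum degree of the initial graph. An adaptive adversary may choose each next deletion depending on the algorithm's previous outputs. Amortized update time is total running time (including initialization) divided by the number of updates. *)

theory Defs
  imports Complex_Main
begin

section \<open>Graphs\<close>

text \<open>Simple undirected graphs with vertex set \<open>V\<close>; an edge is the set of its two endpoints.\<close>

definition simple_graph :: "'v set \<Rightarrow> 'v set set \<Rightarrow> bool" where
  "simple_graph V E \<longleftrightarrow> finite V \<and> (\<forall>e\<in>E. \<exists>u\<in>V. \<exists>v\<in>V. u \<noteq> v \<and> e = {u, v})"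

definition degree :: "'v set set \<Rightarrow> 'v \<Rightarrow> nat" where
  "degree E v = card {e \<in> E. v \<in> e}"

text \<open>The \<open>0\<close> only matters for the graph without vertices.\<close>

definition max_degree :: "'v set \<Rightarrow> 'v set set \<Rightarrow> nat" where
  "max_degree V E = Max (insert 0 (degree E ` V))"

definition clique :: "'v set \<Rightarrow> 'v set set \<Rightarrow> 'v set \<Rightarrow> bool" where
  "clique V E K \<longleftrightarrow> K \<subseteq> V \<and> (\<forall>u\<in>K. \<forall>v\<in>K. u \<noteq> v \<longrightarrow> {u, v} \<in> E)"

definition maximal_clique :: "'v set \<Rightarrow> 'v set set \<Rightarrow> 'v set \<Rightarrow> bool" where
  "maximal_clique V E K \<longleftrightarrow> clique V E K \<and> (\<forall>K'. clique V E K' \<and> K \<subseteq> K' \<longrightarrow> K' = K)"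

section \<open>The word RAM\<close>

text \<open>
  Programs are structured programs over finitely many registers (numbered by naturals) and a
  word-addressed memory. Every instruction and every test of a branch or loop condition
  takes one time unit. \<open>Emit x\<close> writes the content of register \<open>x\<close> to the output.
\<close>

type_synonym reg = nat

datatype binop = Add | Sub | Mult | Div | Mod | Less | Equal

fun apply_binop :: "binop \<Rightarrow> nat \<Rightarrow> nat \<Rightarrow> nat" where
  "apply_binop Add a b = a + b"
| "apply_binop Sub a b = a - b"
| "apply_binop Mult a b = a * b"
| "apply_binop Div a b = a div b"
| "apply_binop Mod a b = a mod b"
| "apply_binop Less a b = (if a < b then 1 else 0)"
| "apply_binop Equal a b = (if a = b then 1 else 0)"

datatype com =
    Skip
  | Set_Const reg nat
  | Bin_Op reg binop reg reg
  | Load reg reg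
  | Store reg reg
  | Emit reg
  | Seq com com
  | If_Nonzero reg com com
  | While_Nonzero reg com

record state =
  regs :: "reg \<Rightarrow> nat"
  mem :: "nat \<Rightarrow> nat"
  out :: "nat list"

text \<open>
  \<open>exec W p s t s'\<close>: started in state \<open>s\<close>, program \<open>p\<close> halts in state \<open>s'\<close> after \<open>t\<close> time units.
  A machine word holds the numbers below \<open>W\<close>; a bound \<open>W\<close> that is polynomial in the number \<open>n\<close> of
  vertices gives words of \<open>O(log n)\<close> bits. An instruction whose result does not fit into a
  word has no successor state, so a program that overflows never halts in the sense
  of this relation.
\<close>

inductive exec :: "nat \<Rightarrow> com \<Rightarrow> state \<Rightarrow> nat \<Rightarrow> state \<Rightarrow> bool" for W :: nat where
  Skip: "exec W Skip s 1 s"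
| Set_Const: "k < W \<Longrightarrow> exec W (Set_Const x k) s 1 (s\<lparr>regs := (regs s)(x := k)\<rparr>)"
| Bin_Op: "k = apply_binop f (regs s y) (regs s z) \<Longrightarrow> k < W \<Longrightarrow>
    exec W (Bin_Op x f y z) s 1 (s\<lparr>regs := (regs s)(x := k)\<rparr>)"
| Load: "exec W (Load x y) s 1 (s\<lparr>regs := (regs s)(x := mem s (regs s y))\<rparr>)"
| Store: "exec W (Store x y) s 1 (s\<lparr>mem := (mem s)(regs s x := regs s y)\<rparr>)"
| Emit: "exec W (Emit x) s 1 (s\<lparr>out := out s @ [regs s x]\<rparr>)"
| Seq: "exec W p s t s' \<Longrightarrow> exec W q s' t' s'' \<Longrightarrow> exec W (Seq p q) s (t + t') s''"
| If_True: "regs s x \<noteq> 0 \<Longrightarrow> exec W p s t s' \<Longrightarrow> exec W (If_Nonzero x p q) s (1 + t) s'"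
| If_False: "regs s x = 0 \<Longrightarrow> exec W q s t s' \<Longrightarrow> exec W (If_Nonzero x p q) s (1 + t) s'"
| While_True: "regs s x \<noteq> 0 \<Longrightarrow> exec W p s t s' \<Longrightarrow> exec W (While_Nonzero x p) s' t' s'' \<Longrightarrow>
    exec W (While_Nonzero x p) s (1 + t + t') s''"
| While_False: "regs s x = 0 \<Longrightarrow> exec W (While_Nonzero x p) s 1 s"

section \<open>Decremental algorithms against an adaptive adversary\<close>

text \<open>
  The initial graph on the vertices \<open>0, \<dots>, n - 1\<close> is given as a list of its edges, each edge
  occurring once, in an arbitrary order and with its endpoints in an arbitrary order.
\<close>

definition lists_edges :: "(nat \<times> nat) list \<Rightarrow> nat set set \<Rightarrow> bool" where
  "lists_edges es E \<longleftrightarrow>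
     distinct (map (\<lambda>(u, v). {u, v}) es) \<and> set (map (\<lambda>(u, v). {u, v}) es) = E"

text \<open>
  Register 0 holds the number of vertices, register 1 the number of edges, and the endpoints of
  the \<open>i\<close>-th edge are at the addresses \<open>2 * i\<close> and \<open>2 * i + 1\<close>. All other registers and memory
  cells are initially 0.
\<close>

definition input_state :: "nat \<Rightarrow> (nat \<times> nat) list \<Rightarrow> state" where
  "input_state n es =
     \<lparr>regs = (\<lambda>_. 0)(0 := n, 1 := length es),
      mem = (\<lambda>a. if a < 2 * length es
                 then (if even a then fst (es ! (a div 2)) else snd (es ! (a div 2)))
                 else 0),
      out = []\<rparr>"

text \<open>An update passes the endpoints of the deleted edge in the registers 0 and 1.\<close>

definition deletion_state :: "nat \<times> nat \<Rightarrow> state \<Rightarrow> state" where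
  "deletion_state e s = s\<lparr>regs := (regs s)(0 := fst e, 1 := snd e), out := []\<rparr>"

text \<open>A dynamic algorithm consists of an initialization program and an update program.\<close>

type_synonym dyn_algorithm = "com \<times> com"

text \<open>
  An adversary chooses the next edge to delete on the basis of all outputs seen so far (the first
  one is that of the initialization). Its own earlier choices are determined by these outputs.
\<close>

type_synonym adversary = "nat list list \<Rightarrow> nat \<times> nat"

text \<open>
  \<open>reaches W A adv n es k E s os T\<close>: after the initialization and \<open>k\<close> deletions chosen by \<open>adv\<close>
  the current edge set is \<open>E\<close>, the machine is in state \<open>s\<close>, the outputs so far are \<open>os\<close>,
  and the total running time, including the initialization, is \<open>T\<close>. The interaction ends
  if the adversary names a pair that is not an edge of the current graph.
\<close>

inductive reaches ::
  "nat \<Rightarrow> dyn_algorithm \<Rightarrow> adversary \<Rightarrow> nat \<Rightarrow> (nat \<times> nat) list \<Rightarrow>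
   nat \<Rightarrow> nat set set \<Rightarrow> state \<Rightarrow> nat list list \<Rightarrow> nat \<Rightarrow> bool"
  for W :: nat and A :: dyn_algorithm and adv :: adversary and n :: nat
    and es :: "(nat \<times> nat) list" where
  init: "exec W (fst A) (input_state n es) t s \<Longrightarrow>
    reaches W A adv n es 0 (set (map (\<lambda>(u, v). {u, v}) es)) s [out s] t"
| update: "reaches W A adv n es k E s os T \<Longrightarrow> adv os = (u, v) \<Longrightarrow> {u, v} \<in> E \<Longrightarrow>
    exec W (snd A) (deletion_state (u, v) s) t s' \<Longrightarrow>
    reaches W A adv n es (Suc k) (E - {{u, v}}) s' (os @ [out s']) (T + t)"

definition always_halts ::
  "nat \<Rightarrow> dyn_algorithm \<Rightarrow> adversary \<Rightarrow> nat \<Rightarrow> (nat \<times> nat) list \<Rightarrow> bool" where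
  "always_halts W A adv n es \<longleftrightarrow>
     (\<exists>t s. exec W (fst A) (input_state n es) t s) \<and>
     (\<forall>k E s os T u v. reaches W A adv n es k E s os T \<and> adv os = (u, v) \<and> {u, v} \<in> E \<longrightarrow>
        (\<exists>t s'. exec W (snd A) (deletion_state (u, v) s) t s'))"

definition maintains_maximal_clique ::
  "nat \<Rightarrow> dyn_algorithm \<Rightarrow> adversary \<Rightarrow> nat \<Rightarrow> (nat \<times> nat) list \<Rightarrow> bool" where
  "maintains_maximal_clique W A adv n es \<longleftrightarrow>
     always_halts W A adv n es \<and>
     (\<forall>k E s os T. reaches W A adv n es k E s os T \<longrightarrow>
        maximal_clique {..<n} E (set (last os)))"

text \<open>
  The amortized update time is the total running time, including the initialization, divided by
  the number of updates. As usual for decremental algorithms, it refers to complete runs, which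
  delete all edges: the initialization cannot be paid for by a few updates alone.
\<close>

definition amortized_update_time_le ::
  "nat \<Rightarrow> dyn_algorithm \<Rightarrow> adversary \<Rightarrow> nat \<Rightarrow> (nat \<times> nat) list \<Rightarrow> real \<Rightarrow> bool" where
  "amortized_update_time_le W A adv n es B \<longleftrightarrow>
     (\<forall>k s os T. reaches W A adv n es k {} s os T \<and> k > 0 \<longrightarrow> real T / real k \<le> B)"

end

theory Submission
  imports Defs
begin

section \<open>Reasoning about programs\<close>

text \<open>The algorithm keeps a clique \<open>K\<close>, one member \<open>r\<close> of it, and
  for every vertex \<open>x\<close> the number \<open>cnt A K x\<close> of its neighbours in
  \<open>K\<close>. Since no vertex is its own neighbour, \<open>x\<close> can join \<open>K\<close>
  exactly when this counter equals \<open>card K\<close>, which is a constant-time test. Adding or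
  removing a vertex changes only the counters of its neighbours and costs O(\<Delta>)
  (\<open>run_toggle\<close>).

  Whatever can extend \<open>K\<close> is a neighbour of \<open>r\<close>, so one scan of the list
  of \<open>r\<close> makes \<open>K\<close> maximal: a vertex rejected during the scan stays
  rejected, because \<open>K\<close> only grows. The same scan outputs \<open>K\<close>, whose
  members other than \<open>r\<close> are all neighbours of \<open>r\<close>. Apart from the
  insertions the scan costs O(\<Delta>) (\<open>run_extend_clique\<close>). When {u, v} is deleted
  and both ends lie in \<open>K\<close>, then \<open>v\<close> is dropped and \<open>u\<close>
  becomes the new \<open>r\<close>; otherwise \<open>K\<close> is still a clique. In both cases a
  scan follows (\<open>run_delete_edge\<close>).

  A single deletion can trigger many insertions, but it removes at most one vertex from
  \<open>K\<close>. Hence the insertions number at most the deletions plus the final size of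
  \<open>K\<close>. The invariant \<open>run_invariant\<close> expresses this by bounding the total
  time with a term proportional to the edges, one proportional to (\<Delta> + 1)(k + 1), and the
  term 28(\<Delta> + 1) \<open>card K\<close>. After a complete run \<open>K\<close> has at most one
  vertex and \<open>k\<close> is the number of initial edges, so the total is O(\<Delta> k).

  Neighbour lists keep the initial neighbours for ever; an adjacency matrix tells which edges are
  still present. Memory starts with zeros, so no array is cleared and initialization costs nothing
  that depends on \<open>n\<close> alone. The algorithm is deterministic and the invariant survives
  the deletion of any edge, so adaptivity does not help the adversary.\<close>

inductive_cases exec_SkipE [elim!]: "exec W Skip s t s'"
inductive_cases exec_Set_ConstE [elim!]: "exec W (Set_Const x k) s t s'"
inductive_cases exec_Bin_OpE [elim!]: "exec W (Bin_Op x f y z) s t s'"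
inductive_cases exec_LoadE [elim!]: "exec W (Load x y) s t s'"
inductive_cases exec_StoreE [elim!]: "exec W (Store x y) s t s'"
inductive_cases exec_EmitE [elim!]: "exec W (Emit x) s t s'"
inductive_cases exec_SeqE [elim!]: "exec W (Seq p q) s t s'"
inductive_cases exec_If_NonzeroE [elim!]: "exec W (If_Nonzero x p q) s t s'"
inductive_cases exec_While_NonzeroE: "exec W (While_Nonzero x p) s t s'"

text \<open>The program proofs exhibit one execution, whereas \<open>reaches\<close> speaks of any;
  determinism identifies the two (\<open>run_exec\<close>).\<close>

lemma exec_deterministic:
  "exec W p s t s' \<Longrightarrow> exec W p s t' s'' \<Longrightarrow> t' = t \<and> s'' = s'"
proof (induction arbitrary: t' s'' rule: exec.induct)
  case (Seq p s t s' q t2 s2)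
  obtain t3 s3 t4 where *: "t' = t3 + t4" "exec W p s t3 s3" "exec W q s3 t4 s''"
    by (rule exec_SeqE[OF Seq.prems])
  show ?case using *(1,3) Seq.IH(1)[OF *(2)] Seq.IH(2)[of t4 s''] by simp
next
  case (While_True s x p t s' t2 s2)
  obtain t3 s3 t4 where *: "t' = 1 + t3 + t4" "exec W p s t3 s3"
    "exec W (While_Nonzero x p) s3 t4 s''"
    by (rule exec_While_NonzeroE[OF While_True.prems]) (use While_True.hyps in simp_all)
  show ?case using *(1,3) While_True.IH(1)[OF *(2)] While_True.IH(2)[of t4 s''] by simp
next
  case (While_False s x p)
  show ?case by (rule exec_While_NonzeroE[OF While_False.prems]) (use While_False.hyps in simp_all)
next
  case (If_True s x p t s' q)
  show ?case
    by (rule exec_If_NonzeroE[OF If_True.prems]) (use If_True.hyps in \<open>auto dest!: If_True.IH\<close>)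
next
  case (If_False s x q t s' p)
  show ?case
    by (rule exec_If_NonzeroE[OF If_False.prems]) (use If_False.hyps in \<open>auto dest!: If_False.IH\<close>)
qed auto

text \<open>A weakest precondition for total correctness whose postcondition also sees the elapsed
  time. As an overflowing program has no execution, it includes the absence of overflow.\<close>

definition run :: "nat \<Rightarrow> com \<Rightarrow> state \<Rightarrow> (nat \<Rightarrow> state \<Rightarrow> bool) \<Rightarrow> bool" where
  "run W p s Q \<longleftrightarrow> (\<exists>t s'. exec W p s t s' \<and> Q t s')"

lemma run_Skip [simp]: "run W Skip s Q \<longleftrightarrow> Q 1 s"
  unfolding run_def by (auto intro: exec.intros[simplified])

lemma run_Set_Const [simp]:
  "run W (Set_Const x k) s Q \<longleftrightarrow> k < W \<and> Q 1 (s\<lparr>regs := (regs s)(x := k)\<rparr>)"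
  unfolding run_def by (auto intro: exec.intros[simplified])

lemma run_Bin_Op [simp]:
  "run W (Bin_Op x f y z) s Q \<longleftrightarrow> apply_binop f (regs s y) (regs s z) < W \<and>
     Q 1 (s\<lparr>regs := (regs s)(x := apply_binop f (regs s y) (regs s z))\<rparr>)"
  unfolding run_def by (auto intro: exec.intros[simplified])

lemma run_Load [simp]:
  "run W (Load x y) s Q \<longleftrightarrow> Q 1 (s\<lparr>regs := (regs s)(x := mem s (regs s y))\<rparr>)"
  unfolding run_def by (auto intro: exec.intros[simplified])

lemma run_Store [simp]:
  "run W (Store x y) s Q \<longleftrightarrow> Q 1 (s\<lparr>mem := (mem s)(regs s x := regs s y)\<rparr>)"
  unfolding run_def by (auto intro: exec.intros[simplified])

lemma run_Emit [simp]:
  "run W (Emit x) s Q \<longleftrightarrow> Q 1 (s\<lparr>out := out s @ [regs s x]\<rparr>)"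
  unfolding run_def by (auto intro: exec.intros[simplified])

lemma run_Seq [simp]:
  "run W (Seq p q) s Q \<longleftrightarrow> run W p s (\<lambda>t s'. run W q s' (\<lambda>t'. Q (t + t')))"
  unfolding run_def
  by (auto intro: exec.intros)

lemma run_If_Nonzero [simp]:
  "run W (If_Nonzero x p q) s Q \<longleftrightarrow>
     (if regs s x \<noteq> 0 then run W p s (\<lambda>t. Q (1 + t)) else run W q s (\<lambda>t. Q (1 + t)))"
  unfolding run_def
  by auto
    (blast intro: exec.If_True[simplified] exec.If_False[simplified])+

lemma run_mono: "run W p s Q \<Longrightarrow> (\<And>t s'. Q t s' \<Longrightarrow> R t s') \<Longrightarrow> run W p s R"
  unfolding run_def by blast

lemma run_exec: "run W p s Q \<Longrightarrow> exec W p s t s' \<Longrightarrow> Q t s'"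
  unfolding run_def using exec_deterministic by blast

lemma run_While_False: "regs s x = 0 \<Longrightarrow> Q 1 s \<Longrightarrow> run W (While_Nonzero x p) s Q"
  unfolding run_def by (blast intro: exec.intros)

lemma run_While_True:
  "regs s x \<noteq> 0 \<Longrightarrow> run W p s (\<lambda>t s'. run W (While_Nonzero x p) s' (\<lambda>t'. Q (1 + t + t'))) \<Longrightarrow>
   run W (While_Nonzero x p) s Q"
  unfolding run_def by (blast intro: exec.intros)

text \<open>Register 5 is reserved for the constant 1 and register 6 for the constant 0.\<close>

definition for_loop :: "reg \<Rightarrow> reg \<Rightarrow> reg \<Rightarrow> com \<Rightarrow> com" where
  "for_loop i l b p =
     Seq (Set_Const i 0) (Seq (Bin_Op b Less i l)
       (While_Nonzero b (Seq p (Seq (Bin_Op i Add i 5) (Bin_Op b Less i l)))))"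

text \<open>In \<open>I k t s\<close>, \<open>t\<close> is the time of the first \<open>k\<close>
  passes. Each pass costs 3 on top of its body: the test, the increment and the comparison. The
  final 3 are the two instructions ahead of the loop and the last, failing test. By
  \<open>ctl\<close> the invariant must ignore the counter and the flag register.\<close>

lemma run_for_loop:
  assumes distinct: "distinct [i, l, b, 5]"
    and W: "N + 1 < W" and l: "regs s l = N" and one: "regs s 5 = 1"
    and start: "I 0 0 s"
    and ctl: "\<And>k t s x y. I k t s \<Longrightarrow> I k t (s\<lparr>regs := (regs s)(i := x, b := y)\<rparr>)"
    and body: "\<And>k t s. k < N \<Longrightarrow> I k t s \<Longrightarrow> regs s i = k \<Longrightarrow> regs s l = N \<Longrightarrow> regs s 5 = 1 \<Longrightarrow>
      run W p s (\<lambda>t' s'. I (Suc k) (t + t' + 3) s' \<and> regs s' i = k \<and> regs s' l = N \<and> regs s' 5 = 1)"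
    and final: "\<And>t s. I N t s \<Longrightarrow> Q (t + 3) s"
  shows "run W (for_loop i l b p) s Q"
proof -
  let ?w = "While_Nonzero b (Seq p (Seq (Bin_Op i Add i 5) (Bin_Op b Less i l)))"
  have loop: "run W ?w s (\<lambda>t'. Q (t + t' + 2))"
    if "k \<le> N" "I k t s" "regs s i = k" "regs s l = N" "regs s 5 = 1"
      "regs s b = (if k < N then 1 else 0)" for k t s
    using that
  proof (induction "N - k" arbitrary: k t s)
    case 0
    then show ?case using final[of t s] by (intro run_While_False) (auto simp: eval_nat_numeral)
  next
    case (Suc d)
    then have k: "k < N" by simp
    show ?case
    proof (rule run_While_True)
      show "regs s b \<noteq> 0" using Suc k by simp
      show "run W (Seq p (Seq (Bin_Op i Add i 5) (Bin_Op b Less i l))) s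
        (\<lambda>u s'. run W ?w s' (\<lambda>t'. Q (t + (1 + u + t') + 2)))"
        unfolding run_Seq
      proof (rule run_mono[OF body[OF k Suc.prems(2-5)]])
        fix u s' assume *: "I (Suc k) (t + u + 3) s' \<and> regs s' i = k \<and> regs s' l = N \<and> regs s' 5 = 1"
        let ?s = "s'\<lparr>regs := (regs s')(i := k + 1, b := if k + 1 < N then 1 else 0)\<rparr>"
        have "run W ?w ?s (\<lambda>t'. Q ((t + u + 3) + t' + 2))"
          using Suc.hyps(2) k * distinct ctl by (intro Suc.hyps(1)[of "Suc k"]) auto
        then show "run W (Bin_Op i Add i 5) s' (\<lambda>v s''. run W (Bin_Op b Less i l) s''
          (\<lambda>v' s3. run W ?w s3 (\<lambda>t'. Q (t + (1 + (u + (v + v')) + t') + 2))))"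
          using * k W distinct by (auto simp: algebra_simps eval_nat_numeral)
      qed
    qed
  qed
  let ?s = "s\<lparr>regs := (regs s)(i := 0, b := if 0 < N then 1 else 0)\<rparr>"
  have "run W ?w ?s (\<lambda>t'. Q (0 + t' + 2))"
    using start ctl l one distinct by (intro loop[of 0]) auto
  then show ?thesis
    unfolding for_loop_def using W l distinct by auto
qed

section \<open>Arrays in memory\<close>

text \<open>Array \<open>j\<close> is a block of \<open>n * n\<close> cells. One-dimensional arrays
  use column 0 of such a block, so that a single injectivity fact separates all cells in
  use.\<close>

definition addr :: "nat \<Rightarrow> nat \<Rightarrow> nat \<Rightarrow> nat \<Rightarrow> nat" where
  "addr n j u v = (j * n + u) * n + v"

lemma addr_eq_iff [simp]:
  assumes "u < n" "v < n" "u' < n" "v' < n"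
  shows "addr n j u v = addr n j' u' v' \<longleftrightarrow> j = j' \<and> u = u' \<and> v = v'"
proof -
  have *: "a * n + b = a' * n + b' \<longleftrightarrow> a = a' \<and> b = b'" if "b < n" "b' < n" for a b a' b'
  proof
    assume eq: "a * n + b = a' * n + b'"
    have "(a * n + b) div n = a" "(a' * n + b') div n = a'" using that by auto
    with eq have "a = a'" by metis
    with eq show "a = a' \<and> b = b'" by simp
  qed simp
  show ?thesis unfolding addr_def using assms by (simp add: *)
qed

lemma addr_ge: "j \<ge> 1 \<Longrightarrow> n * n \<le> addr n j u v"
  unfolding addr_def by (metis le_add1 mult_le_mono1 mult_1 order_trans)

definition address :: "nat \<Rightarrow> reg \<Rightarrow> reg \<Rightarrow> com" where
  "address j a b = Seq (Set_Const 7 j) (Seq (Bin_Op 7 Mult 7 2) (Seq (Bin_Op 7 Add 7 a)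
     (Seq (Bin_Op 7 Mult 7 2) (Bin_Op 7 Add 7 b))))"

definition get :: "reg \<Rightarrow> nat \<Rightarrow> reg \<Rightarrow> reg \<Rightarrow> com" where
  "get x j a b = Seq (address j a b) (Load x 7)"

definition put :: "nat \<Rightarrow> reg \<Rightarrow> reg \<Rightarrow> reg \<Rightarrow> com" where
  "put j a b x = Seq (address j a b) (Store 7 x)"

text \<open>The last array has number 6 and ends before \<open>7 * n * n\<close>, so all addresses
  and the intermediate results of computing them fit into a word.\<close>

locale word_size =
  fixes n W :: nat
  assumes W: "7 * n * n + 7 * n + 7 < W"
begin

lemma run_address:
  assumes "regs s 2 = n" "a \<noteq> 7" "b \<noteq> 7" "j \<le> 6" "regs s a < n" "regs s b < n"
  shows "run W (address j a b) s Q \<longleftrightarrow>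
    Q 5 (s\<lparr>regs := (regs s)(7 := addr n j (regs s a) (regs s b))\<rparr>)"
proof -
  have 1: "j * n \<le> 6 * n" using assms by simp
  then have 2: "j * n + regs s a \<le> 7 * n" using assms by linarith
  then have 3: "(j * n + regs s a) * n \<le> 7 * n * n" by simp
  have "j < W" "j * n < W" "j * n + regs s a < W" "(j * n + regs s a) * n < W"
    "(j * n + regs s a) * n + regs s b < W"
    using assms(4-6) 1 2 3 W by linarith+
  then show ?thesis
    unfolding address_def using assms by (simp add: addr_def eval_nat_numeral)
qed

lemma run_get [simp]:
  assumes "regs s 2 = n" "a \<noteq> 7" "b \<noteq> 7" "j \<le> 6" "regs s a < n" "regs s b < n"
  shows "run W (get x j a b) s Q \<longleftrightarrow>
    Q 6 (s\<lparr>regs := (regs s)(7 := addr n j (regs s a) (regs s b),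
      x := mem s (addr n j (regs s a) (regs s b)))\<rparr>)"
  unfolding get_def using assms by (simp add: run_address)

lemma run_put [simp]:
  assumes "regs s 2 = n" "a \<noteq> 7" "b \<noteq> 7" "x \<noteq> 7" "j \<le> 6" "regs s a < n" "regs s b < n"
  shows "run W (put j a b x) s Q \<longleftrightarrow>
    Q 6 (s\<lparr>regs := (regs s)(7 := addr n j (regs s a) (regs s b)),
      mem := (mem s)(addr n j (regs s a) (regs s b) := regs s x)\<rparr>)"
  unfolding put_def using assms by (simp add: run_address)

end

text \<open>
  The arrays start at address \<open>2 * n * n\<close>, beyond the input. Those numbered 6, 2, 3, 4, 5 hold the adjacency
  matrix, the neighbour lists, their lengths, the counters and the characteristic function of the clique.
\<close>

definition stores ::
  "nat \<Rightarrow> (nat \<times> nat) set \<Rightarrow> (nat \<Rightarrow> nat \<Rightarrow> nat) \<Rightarrow> (nat \<Rightarrow> nat) \<Rightarrow> (nat \<Rightarrow> nat) \<Rightarrow> nat set \<Rightarrow>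
   (nat \<Rightarrow> nat) \<Rightarrow> bool" where
  "stores n A L d c K m \<longleftrightarrow>
     (\<forall>u<n. \<forall>v<n. m (addr n 6 u v) = of_bool ((u, v) \<in> A) \<and> m (addr n 2 u v) = L u v) \<and>
     (\<forall>u<n. m (addr n 3 u 0) = d u \<and> m (addr n 4 u 0) = c u \<and> m (addr n 5 u 0) = of_bool (u \<in> K))"

lemma stores_get:
  assumes "stores n A L d c K m" "u < n"
  shows "v < n \<Longrightarrow> m (addr n 6 u v) = of_bool ((u, v) \<in> A)"
    and "v < n \<Longrightarrow> m (addr n 2 u v) = L u v"
    and "m (addr n 3 u 0) = d u" "m (addr n 4 u 0) = c u" "m (addr n 5 u 0) = of_bool (u \<in> K)"
  using assms by (auto simp: stores_def)

text \<open>The last clause only asks that the two sets agree away from \<open>u\<close>; thus it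
  serves insertion and removal alike.\<close>

lemma stores_put:
  assumes "stores n A L d c K m" "u < n"
  shows "v < n \<Longrightarrow> A' = insert (u, v) A \<Longrightarrow> stores n A' L d c K (m(addr n 6 u v := Suc 0))"
    and "v < n \<Longrightarrow> A' = A - {(u, v)} \<Longrightarrow> stores n A' L d c K (m(addr n 6 u v := 0))"
    and "v < n \<Longrightarrow> L' = L(u := (L u)(v := y)) \<Longrightarrow> stores n A L' d c K (m(addr n 2 u v := y))"
    and "d' = d(u := y) \<Longrightarrow> stores n A L d' c K (m(addr n 3 u 0 := y))"
    and "c' = c(u := y) \<Longrightarrow> stores n A L d c' K (m(addr n 4 u 0 := y))"
    and "K' - {u} = K - {u} \<Longrightarrow> y = of_bool (u \<in> K') \<Longrightarrow> stores n A L d c K' (m(addr n 5 u 0 := y))"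
  using assms by (auto simp: stores_def)

section \<open>The algorithm\<close>

text \<open>
  Register 2 holds \<open>n\<close>, register 3 the size of \<open>K\<close> and register 4 the vertex \<open>r\<close>.
  \<open>toggle f\<close> adds (\<open>f = Add\<close>) or removes (\<open>f = Sub\<close>) the vertex in register 8.
\<close>

definition toggle :: "binop \<Rightarrow> com" where
  "toggle f =
     Seq (get 13 5 8 6) (Seq (Bin_Op 13 f 13 5) (Seq (put 5 8 6 13) (Seq (Bin_Op 3 f 3 5)
     (Seq (get 10 3 8 6) (for_loop 9 10 11
       (Seq (get 12 2 8 9) (Seq (get 13 6 8 12) (Seq (get 14 4 12 6)
         (Seq (Bin_Op 14 f 14 13) (put 4 12 6 14))))))))))"

text \<open>A vertex is tested for output after its possible insertion, so a single scan both
  extends the clique and prints it.\<close>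

definition extend_clique :: com where
  "extend_clique =
     Seq (Emit 4) (Seq (get 16 3 4 6) (for_loop 15 16 17
       (Seq (get 8 2 4 15) (Seq (get 13 4 8 6) (Seq (Bin_Op 13 Equal 13 3)
         (Seq (If_Nonzero 13 (toggle Add) Skip)
         (Seq (get 13 5 8 6) (If_Nonzero 13 (Emit 8) Skip))))))))"

text \<open>The membership bits of both endpoints are needed for the counters anyway; their product
  is left in register 13 as the flag that the clique has lost an edge. The neighbour lists stay
  untouched.\<close>

definition unlink :: com where
  "unlink =
     Seq (get 13 5 0 6) (Seq (get 14 4 1 6) (Seq (Bin_Op 14 Sub 14 13) (Seq (put 4 1 6 14)
     (Seq (get 12 5 1 6) (Seq (get 14 4 0 6) (Seq (Bin_Op 14 Sub 14 12) (Seq (put 4 0 6 14)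
     (Seq (put 6 0 1 6) (Seq (put 6 1 0 6) (Bin_Op 13 Mult 13 12))))))))))"

text \<open>The vertex \<open>r\<close> is moved to \<open>u\<close> because the old one may be the
  vertex \<open>v\<close> that is dropped. Adding register 6 is a copy.\<close>

definition delete_edge :: com where
  "delete_edge =
     Seq unlink (Seq (If_Nonzero 13
       (Seq (Bin_Op 4 Add 0 6) (Seq (Bin_Op 8 Add 1 6) (toggle Sub))) Skip) extend_clique)"

definition link :: "reg \<Rightarrow> reg \<Rightarrow> com" where
  "link a b =
     Seq (get 13 3 a 6) (Seq (put 2 a 13 b) (Seq (Bin_Op 13 Add 13 5) (Seq (put 3 a 6 13)
       (put 6 a b 5))))"

text \<open>Registers 4 and 8 are still 0 after the lists are built, so vertex 0 becomes
  \<open>r\<close> and is the first member of the clique. The outer test keeps this from happening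
  in a graph without vertices.\<close>

definition initialize :: com where
  "initialize =
     If_Nonzero 0
       (Seq (Bin_Op 2 Add 0 6) (Seq (Set_Const 5 1)
       (Seq (for_loop 15 1 17
         (Seq (Bin_Op 14 Add 15 15) (Seq (Load 18 14) (Seq (Bin_Op 14 Add 14 5) (Seq (Load 19 14)
           (Seq (link 18 19) (link 19 18))))))) (Seq (toggle Add) extend_clique)))) Skip"

section \<open>Counting neighbours inside the clique\<close>

definition cnt :: "(nat \<times> nat) set \<Rightarrow> nat set \<Rightarrow> nat \<Rightarrow> nat" where
  "cnt A K x = card (K \<inter> A `` {x})"

lemma cnt_le: "finite K \<Longrightarrow> cnt A K x \<le> card K"
  unfolding cnt_def by (intro card_mono) auto

text \<open>This justifies the test in \<open>extend_clique\<close>, which compares a counter with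
  the size of the clique.\<close>

lemma cnt_eq_card: "finite K \<Longrightarrow> cnt A K x = card K \<longleftrightarrow> K \<subseteq> A `` {x}"
  unfolding cnt_def using card_subset_eq[of K "K \<inter> A `` {x}"] by (auto simp: Int_absorb2)

lemma cnt_insert:
  "finite K \<Longrightarrow> w \<notin> K \<Longrightarrow> cnt A (insert w K) x = cnt A K x + of_bool ((x, w) \<in> A)"
  unfolding cnt_def by (simp add: Int_insert_left)

lemma cnt_remove:
  assumes "finite K" "w \<in> K"
  shows "cnt A (K - {w}) x = cnt A K x - of_bool ((x, w) \<in> A)"
  using cnt_insert[of "K - {w}" w A x] assms by (simp add: insert_absorb)

lemma cnt_delete_edge:
  assumes "finite K" "(u, v) \<in> A" "(v, u) \<in> A" "u \<noteq> v"
  shows "cnt (A - {(u, v), (v, u)}) K =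
    (cnt A K)(v := cnt A K v - of_bool (u \<in> K), u := cnt A K u - of_bool (v \<in> K))"
proof
  fix x
  let ?A = "A - {(u, v), (v, u)}"
  have "K \<inter> ?A `` {v} = K \<inter> A `` {v} - {u}" "K \<inter> ?A `` {u} = K \<inter> A `` {u} - {v}"
    "x \<noteq> u \<Longrightarrow> x \<noteq> v \<Longrightarrow> ?A `` {x} = A `` {x}"
    using assms by auto
  then show "cnt ?A K x =
    ((cnt A K)(v := cnt A K v - of_bool (u \<in> K), u := cnt A K u - of_bool (v \<in> K))) x"
    using assms by (auto simp: cnt_def card_Diff_singleton_if)
qed

text \<open>\<open>S\<close> are the arcs of the initial graph; the current ones are a subset \<open>A\<close> of \<open>S\<close>.\<close>

locale neighbour_lists = word_size +
  fixes S :: "(nat \<times> nat) set" and L :: "nat \<Rightarrow> nat \<Rightarrow> nat" and d :: "nat \<Rightarrow> nat" and D :: nat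
  assumes S: "S \<subseteq> {..<n} \<times> {..<n}"
    and L: "\<And>u. u < n \<Longrightarrow> bij_betw (L u) {..<d u} (S `` {u})"
    and D: "\<And>u. u < n \<Longrightarrow> d u \<le> D"
begin

section \<open>Correctness and cost of the clique operations over fixed neighbour lists\<close>

lemma L_in: "u < n \<Longrightarrow> i < d u \<Longrightarrow> (u, L u i) \<in> S"
  using L[of u] by (auto simp: bij_betw_def)

lemma L_less: "u < n \<Longrightarrow> i < d u \<Longrightarrow> L u i < n"
  using L_in S by blast

lemma L_obtain:
  assumes "(u, v) \<in> S" obtains i where "i < d u" "v = L u i"
proof -
  have "u < n" using assms S by auto
  then have "v \<in> L u ` {..<d u}" using L[of u] assms by (auto simp: bij_betw_def)
  then show ?thesis using that by auto
qed

lemma d_le: "u < n \<Longrightarrow> d u \<le> n"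
  using card_mono[of "{..<n}" "S `` {u}"] bij_betw_same_card[OF L[of u]] S by auto

text \<open>The list of \<open>w\<close> may contain former neighbours. What is added to or
  subtracted from a counter is the matrix bit, so stale entries change nothing.\<close>

lemma run_toggle:
  assumes mem: "stores n A L d c K (mem s)" and "A \<subseteq> S" "w < n"
    and regs: "regs s 2 = n" "regs s 5 = 1" "regs s 6 = 0" "regs s 8 = w" "regs s 3 \<le> n"
    and c: "\<And>x. x < n \<Longrightarrow> c x \<le> n"
    and f: "f = Add \<and> w \<notin> K \<and> K' = insert w K \<or> f = Sub \<and> w \<in> K \<and> K' = K - {w}"
    and Q: "\<And>t s'. stores n A L d (\<lambda>x. apply_binop f (c x) (of_bool ((w, x) \<in> A))) K' (mem s') \<Longrightarrow>
      (\<forall>x. x \<notin> {3, 7, 9, 10, 11, 12, 13, 14} \<longrightarrow> regs s' x = regs s x) \<Longrightarrow>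
      regs s' 3 = apply_binop f (regs s 3) 1 \<Longrightarrow> out s' = out s \<Longrightarrow> t \<le> 28 * (D + 1) \<Longrightarrow> Q t s'"
  shows "run W (toggle f) s Q"
proof -
  let ?g = "\<lambda>x. apply_binop f (c x) (of_bool ((w, x) \<in> A))"
  \<comment> \<open>Counters after \<open>i\<close> list entries. As \<open>L w\<close> is injective
    on its range of indices, no vertex is updated twice.\<close>
  let ?c = "\<lambda>i x. if x \<in> L w ` {..<i} then ?g x else c x"
  let ?I = "\<lambda>(s1 :: state) i t (s' :: state). stores n A L d (?c i) K' (mem s') \<and>
    (\<forall>x. x \<notin> {7, 9, 11, 12, 13, 14} \<longrightarrow> regs s' x = regs s1 x) \<and> out s' = out s \<and> t = 28 * i"
  have small: "apply_binop f a b < W" if "a \<le> n" "b \<le> 1" for a b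
    using f that W by (auto simp: algebra_simps)
  \<comment> \<open>A vertex missing from the list is no neighbour of \<open>w\<close>, since
    \<open>A\<close> is contained in \<open>S\<close>; its counter needs no change.\<close>
  have full: "?c (d w) = ?g"
  proof
    fix x
    show "?c (d w) x = ?g x"
    proof (cases "x \<in> L w ` {..<d w}")
      case False
      then have "(w, x) \<notin> A" using L_obtain[of w x] \<open>A \<subseteq> S\<close> by blast
      then show ?thesis using f by auto
    qed simp
  qed
  have loop: "run W (for_loop 9 10 11 (Seq (get 12 2 8 9) (Seq (get 13 6 8 12) (Seq (get 14 4 12 6)
         (Seq (Bin_Op 14 f 14 13) (put 4 12 6 14)))))) s1 (\<lambda>t. Q (t + 20))"
    if m1: "stores n A L d c K' (mem s1)"
      and r1: "\<forall>x. x \<notin> {3, 7, 9, 10, 11, 12, 13, 14} \<longrightarrow> regs s1 x = regs s x"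
      "regs s1 3 = apply_binop f (regs s 3) 1" "regs s1 10 = d w" "out s1 = out s" for s1
  proof (rule run_for_loop[where I = "?I s1" and N = "d w"])
    show "d w + 1 < W" using d_le[of w] \<open>w < n\<close> W by linarith
    show "?I s1 0 0 s1" using m1 r1 by simp
  next
    fix i t s' assume i: "i < d w" and I: "?I s1 i t s'" and r: "regs s' 9 = i"
    have rr: "regs s' 2 = n" "regs s' 5 = 1" "regs s' 6 = 0" "regs s' 8 = w" "regs s' 10 = d w"
      using I r1 regs by auto
    have x: "L w i < n" and "i < n" using L_less \<open>w < n\<close> i d_le[of w] by auto
    have "L w i \<notin> L w ` {..<i}"
      using bij_betw_imp_inj_on[OF L[OF \<open>w < n\<close>]] i by (auto dest: inj_onD)
    then have c1: "?c i (L w i) = c (L w i)" by simp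
    have c2: "?c (Suc i) = (?c i)(L w i := ?g (L w i))"
      by (auto simp: lessThan_Suc)
    show "run W (Seq (get 12 2 8 9) (Seq (get 13 6 8 12) (Seq (get 14 4 12 6)
         (Seq (Bin_Op 14 f 14 13) (put 4 12 6 14))))) s'
      (\<lambda>t' s''. ?I s1 (Suc i) (t + t' + 3) s'' \<and> regs s'' 9 = i \<and> regs s'' 10 = d w \<and> regs s'' 5 = 1)"
      using I rr r x \<open>i < n\<close> \<open>w < n\<close> small[OF c[OF x]]
      by (simp add: stores_get[OF I[THEN conjunct1]] c1 stores_put(5)[OF _ _ c2])
  next
    fix t s' assume I: "?I s1 (d w) t s'"
    then have *: "stores n A L d ?g K' (mem s')" unfolding full by blast
    show "Q (t + 3 + 20) s'"
      by (rule Q) (use * I r1 D[OF \<open>w < n\<close>] in auto)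
  qed (use r1 regs in auto)
  have y: "apply_binop f (of_bool (w \<in> K)) 1 = of_bool (w \<in> K')" using f by auto
  have "run W (for_loop 9 10 11 (Seq (get 12 2 8 9) (Seq (get 13 6 8 12) (Seq (get 14 4 12 6)
         (Seq (Bin_Op 14 f 14 13) (put 4 12 6 14))))))
     (s\<lparr>mem := (mem s)(addr n 5 w 0 := of_bool (w \<in> K')), regs := (regs s)(13 := of_bool (w \<in> K'),
        3 := apply_binop f (regs s 3) 1, 7 := addr n 3 w 0, 10 := d w)\<rparr>) (\<lambda>t. Q (t + 20))"
    by (rule loop) (use mem f \<open>w < n\<close> in \<open>auto intro!: stores_put(6)\<close>)
  then show ?thesis
    unfolding toggle_def using mem regs \<open>w < n\<close> small[of "of_bool (w \<in> K)" 1] small[of "regs s 3" 1] y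
    by (cases "w \<in> K'") (simp_all add: stores_get[OF mem] add.commute)
qed

definition represents :: "(nat \<times> nat) set \<Rightarrow> nat set \<Rightarrow> state \<Rightarrow> bool" where
  "represents A K s \<longleftrightarrow>
     stores n A L d (cnt A K) K (mem s) \<and> K \<subseteq> {..<n} \<and> pairwise (\<lambda>u v. (u, v) \<in> A) K \<and>
     regs s 2 = n \<and> regs s 3 = card K \<and> regs s 4 \<in> K \<and> regs s 5 = 1 \<and> regs s 6 = 0"

text \<open>The time bound charges each insertion to the growth of \<open>card K\<close>; only the
  bare scan, 26 units per list entry plus a constant, remains to be paid.\<close>

lemma run_extend_clique:
  assumes A: "A \<subseteq> S" "sym A" "irrefl A"
    and s: "represents A K s" "out s = []"
    and Q: "\<And>K' t s'. represents A K' s' \<Longrightarrow> K \<subseteq> K' \<Longrightarrow>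
      (\<forall>x<n. x \<notin> K' \<longrightarrow> (\<exists>w\<in>K'. (x, w) \<notin> A)) \<Longrightarrow> set (out s') = K' \<Longrightarrow>
      t + 28 * (D + 1) * card K \<le> 26 * (D + 1) + 28 * (D + 1) * card K' \<Longrightarrow> Q t s'"
  shows "run W extend_clique s Q"
proof -
  define r where "r = regs s 4"
  have r: "r < n" using s by (auto simp: represents_def r_def)
  \<comment> \<open>Every scanned vertex is in the clique or has a non-neighbour there. Both
    alternatives persist when the clique grows, which is why one pass is enough.\<close>
  let ?I = "\<lambda>i t (s' :: state). \<exists>K'. K \<subseteq> K' \<and> represents A K' s' \<and> regs s' 4 = r \<and>
    (\<forall>j<i. L r j \<in> K' \<or> (\<exists>w\<in>K'. (L r j, w) \<notin> A)) \<and>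
    set (out s') = insert r (K' \<inter> L r ` {..<i}) \<and>
    t + 28 * (D + 1) * card K \<le> 26 * i + 28 * (D + 1) * card K'"
  define e where "e = Seq (get 13 5 8 6) (If_Nonzero 13 (Emit 8) Skip)"
  let ?p = "Seq (get 8 2 4 15) (Seq (get 13 4 8 6) (Seq (Bin_Op 13 Equal 13 3)
         (Seq (If_Nonzero 13 (toggle Add) Skip) e)))"
  let ?s = "s\<lparr>out := [r], regs := (regs s)(7 := addr n 3 r 0, 16 := d r)\<rparr>"
  have "run W (for_loop 15 16 17 ?p) ?s (\<lambda>t. Q (7 + t))"
  proof (rule run_for_loop[where I = ?I and N = "d r"])
    show "d r + 1 < W" using d_le[OF r] W by linarith
    show "?I 0 0 ?s" using s by (auto simp: represents_def r_def)
    show "regs ?s 5 = 1" using s by (auto simp: represents_def)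
    show "?I k t (s\<lparr>regs := (regs s)(15 := x, 17 := y)\<rparr>)" if "?I k t s" for k t s x y
      using that by (simp add: represents_def)
  next
    fix i t s1
    assume i: "i < d r" and I: "?I i t s1" and ctl: "regs s1 15 = i" "regs s1 16 = d r" "regs s1 5 = 1"
    obtain K1 where K1: "K \<subseteq> K1" "represents A K1 s1" "regs s1 4 = r"
      "\<forall>j<i. L r j \<in> K1 \<or> (\<exists>w\<in>K1. (L r j, w) \<notin> A)"
      "set (out s1) = insert r (K1 \<inter> L r ` {..<i})"
      "t + 28 * (D + 1) * card K \<le> 26 * i + 28 * (D + 1) * card K1"
      using I by blast
    define x where "x = L r i"
    have x: "x < n" "i < n" using L_less[OF r i] d_le[OF r] i by (auto simp: x_def)
    have m: "stores n A L d (cnt A K1) K1 (mem s1)" and "K1 \<subseteq> {..<n}"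
      and cl: "pairwise (\<lambda>u v. (u, v) \<in> A) K1"
      and regs: "regs s1 2 = n" "regs s1 3 = card K1" "regs s1 6 = 0"
      using K1(2) by (auto simp: represents_def)
    then have fin: "finite K1" by (auto intro: finite_subset)
    have card: "card K1 \<le> n" using card_mono[OF _ \<open>K1 \<subseteq> {..<n}\<close>] by simp
    note get = stores_get[OF m]
    define R where "R t' s' \<longleftrightarrow> ?I (Suc i) (t + t' + 3) s' \<and> regs s' 15 = i \<and> regs s' 16 = d r \<and> regs s' 5 = 1" for t' s'
    have "run W ?p s1 R"
    proof (cases "cnt A K1 x = card K1")
      case True
      then have adj: "K1 \<subseteq> A `` {x}" using fin by (simp add: cnt_eq_card)
      then have xK: "x \<notin> K1" using A(3) by (auto simp: irrefl_def)
      have c: "(\<lambda>y. apply_binop Add (cnt A K1 y) (of_bool ((x, y) \<in> A))) = cnt A (insert x K1)"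
        using cnt_insert[OF fin xK] A(2) by (auto simp: fun_eq_iff sym_def)
      let ?s1 = "s1\<lparr>regs := (regs s1)(8 := x, 7 := addr n 4 x 0, 13 := 1)\<rparr>"
      have "run W (toggle Add) ?s1 (\<lambda>t' s'. run W e s' (\<lambda>t''. R (14 + t' + t'')))"
      proof (rule run_toggle[OF _ A(1) x(1), of _ _ _ _ "insert x K1"])
        show "stores n A L d (cnt A K1) K1 (mem ?s1)" using m by simp
        show "cnt A K1 y \<le> n" for y using cnt_le[OF fin, of A y] card by linarith
      next
        fix t' and s' :: state
        assume m': "stores n A L d (\<lambda>y. apply_binop Add (cnt A K1 y) (of_bool ((x, y) \<in> A)))
            (insert x K1) (mem s')"
          and k': "\<forall>y. y \<notin> {3, 7, 9, 10, 11, 12, 13, 14} \<longrightarrow> regs s' y = regs ?s1 y"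
          and s': "regs s' 3 = apply_binop Add (regs ?s1 3) 1" "out s' = out ?s1" "t' \<le> 28 * (D + 1)"
        have "represents A (insert x K1) s'"
          using m' k' s' regs ctl K1(2,3) adj fin xK x A(2) unfolding c
          by (auto simp: represents_def pairwise_insert sym_def)
        moreover have "\<forall>j<Suc i. L r j \<in> insert x K1 \<or> (\<exists>w\<in>insert x K1. (L r j, w) \<notin> A)"
          using K1(4) by (auto simp: less_Suc_eq x_def)
        moreover have "insert x (set (out s')) = insert r (insert x K1 \<inter> L r ` {..<Suc i})"
          using K1(5) s' by (auto simp: lessThan_Suc x_def)
        \<comment> \<open>14 and 8 are the instructions before and after \<open>toggle\<close>;
          together with the loop overhead they fit into 26, and the cost of \<open>toggle\<close> is
          matched by the new member.\<close>
        moreover have "t + (14 + t' + 8) + 3 + 28 * (D + 1) * card K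
            \<le> 26 * Suc i + 28 * (D + 1) * card (insert x K1)"
          using K1(6) s'(3) xK fin by (simp add: algebra_simps)
        ultimately have fin': "?I (Suc i) (t + (14 + t' + 8) + 3)
            (s'\<lparr>regs := (regs s')(7 := addr n 5 x 0, 13 := 1), out := out s' @ [x]\<rparr>)"
          using K1(1,3) k' by (intro exI[of _ "insert x K1"]) (auto simp: represents_def)
        show "run W e s' (\<lambda>t''. R (14 + t' + t''))"
          using k' regs ctl x fin' by (simp add: e_def stores_get[OF m'] R_def)
      qed (use regs ctl card xK in auto)
      then show ?thesis
        using regs ctl x r K1(3) True W by (simp add: get x_def[symmetric] algebra_simps)
    next
      case False
      then have "\<exists>w\<in>K1. (x, w) \<notin> A" using fin by (auto simp: cnt_eq_card)
      then have "\<forall>j<Suc i. L r j \<in> K1 \<or> (\<exists>w\<in>K1. (L r j, w) \<notin> A)"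
        using K1(4) by (auto simp: less_Suc_eq x_def)
      moreover have "(if x \<in> K1 then insert x (set (out s1)) else set (out s1)) =
          insert r (K1 \<inter> L r ` {..<Suc i})"
        using K1(5) by (auto simp: lessThan_Suc x_def)
      moreover have "t + 26 + 28 * (D + 1) * card K \<le> 26 * Suc i + 28 * (D + 1) * card K1"
        using K1(6) by simp
      ultimately have "?I (Suc i) (t + 23 + 3) (s1\<lparr>regs := (regs s1)(8 := x, 7 := addr n 5 x 0,
            13 := of_bool (x \<in> K1)), out := out s1 @ (if x \<in> K1 then [x] else [])\<rparr>)"
        using K1(1-3) by (intro exI[of _ K1]) (auto simp: represents_def split: if_splits)
      then show ?thesis
        using regs ctl x r K1(3) False W
        by (cases "x \<in> K1") (simp_all add: get x_def[symmetric] e_def R_def)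
    qed
    then show "run W ?p s1 (\<lambda>t' s'. ?I (Suc i) (t + t' + 3) s' \<and> regs s' 15 = i \<and> regs s' 16 = d r \<and> regs s' 5 = 1)"
      unfolding R_def .
  next
    fix t s' assume "?I (d r) t s'"
    then obtain K' where K': "K \<subseteq> K'" "represents A K' s'" "regs s' 4 = r"
      "\<forall>j<d r. L r j \<in> K' \<or> (\<exists>w\<in>K'. (L r j, w) \<notin> A)"
      "set (out s') = insert r (K' \<inter> L r ` {..<d r})"
      "t + 28 * (D + 1) * card K \<le> 26 * d r + 28 * (D + 1) * card K'"
      by blast
    have rK: "r \<in> K'" using K'(2,3) by (auto simp: represents_def)
    show "Q (7 + (t + 3)) s'"
    proof (rule Q)
      show "\<forall>x<n. x \<notin> K' \<longrightarrow> (\<exists>w\<in>K'. (x, w) \<notin> A)"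
      proof (intro allI impI)
        fix x assume x: "x < n" "x \<notin> K'"
        show "\<exists>w\<in>K'. (x, w) \<notin> A"
        \<comment> \<open>A neighbour of \<open>r\<close> has been scanned; any other vertex is
          blocked by \<open>r\<close> itself.\<close>
        proof (cases "(x, r) \<in> A")
          case True
          then have "(r, x) \<in> S" using A by (auto dest: symD)
          then obtain j where "j < d r" "x = L r j" by (rule L_obtain)
          then show ?thesis using K'(4) x by auto
        qed (use rK in blast)
      qed
      \<comment> \<open>The output is complete: clique members other than \<open>r\<close> are
        current, hence initial, neighbours of \<open>r\<close> and occur in its list.\<close>
      have "x \<in> L r ` {..<d r}" if "x \<in> K'" "x \<noteq> r" for x
      proof -
        have "(r, x) \<in> S" using K'(2) rK that A(1) by (auto simp: represents_def pairwise_def)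
        then show ?thesis by (rule L_obtain) auto
      qed
      then show "set (out s') = K'" using K'(5) rK by auto
      show "7 + (t + 3) + 28 * (D + 1) * card K \<le> 26 * (D + 1) + 28 * (D + 1) * card K'"
        using K'(6) D[OF r] by simp
    qed (use K' in auto)
  qed (use s in auto)
  then show ?thesis
    unfolding extend_clique_def e_def[symmetric] using s r
    by (simp add: represents_def r_def stores_get(3)[where m = "mem s" and A = A and L = L and d = d
          and c = "cnt A K" and K = K])
qed

lemma run_unlink:
  assumes A: "(u, v) \<in> A" "(v, u) \<in> A" "irrefl A" "A \<subseteq> S"
    and m: "stores n A L d (cnt A K) K (mem s)" and K: "K \<subseteq> {..<n}"
    and regs: "regs s 0 = u" "regs s 1 = v" "regs s 2 = n" "regs s 6 = 0"
    and Q: "\<And>t s'. stores n (A - {(u, v), (v, u)}) L d (cnt (A - {(u, v), (v, u)}) K) K (mem s') \<Longrightarrow>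
      (\<forall>x. x \<notin> {7, 12, 13, 14} \<longrightarrow> regs s' x = regs s x) \<Longrightarrow>
      regs s' 13 = of_bool (u \<in> K \<and> v \<in> K) \<Longrightarrow> out s' = out s \<Longrightarrow> t = 51 \<Longrightarrow> Q t s'"
  shows "run W unlink s Q"
proof -
  have uv: "u < n" "v < n" "u \<noteq> v" using A S by (auto simp: irrefl_def)
  have fin: "finite K" and card: "card K \<le> n"
    using finite_subset[OF K] card_mono[OF _ K] by auto
  have small: "cnt A K x - y < W" "cnt A K x < W" for x y
    using cnt_le[OF fin, of A x] card W by linarith+
  let ?c = "(cnt A K)(v := cnt A K v - of_bool (u \<in> K))"
  let ?m = "(mem s)(addr n 4 v 0 := cnt A K v - of_bool (u \<in> K))"
  let ?m' = "?m(addr n 4 u 0 := cnt A K u - of_bool (v \<in> K))"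
  have c': "?c(u := cnt A K u - of_bool (v \<in> K)) = cnt (A - {(u, v), (v, u)}) K"
    using cnt_delete_edge[OF fin A(1,2) uv(3)] by simp
  have *: "stores n A L d ?c K ?m"
    by (rule stores_put(5)[OF m uv(2) refl])
  have "stores n A L d (cnt (A - {(u, v), (v, u)}) K) K ?m'"
    by (rule stores_put(5)[OF * uv(1) c'[symmetric]])
  then have "stores n (A - {(u, v)}) L d (cnt (A - {(u, v), (v, u)}) K) K (?m'(addr n 6 u v := 0))"
    using uv(1,2) by (rule stores_put(2)) simp
  then have m': "stores n (A - {(u, v), (v, u)}) L d (cnt (A - {(u, v), (v, u)}) K) K
      (?m'(addr n 6 u v := 0, addr n 6 v u := 0))"
    using uv(2,1) by (rule stores_put(2)) auto
  show ?thesis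
    unfolding unlink_def
    by (cases "u \<in> K"; cases "v \<in> K"; use uv regs small W in \<open>simp add: stores_get[OF m]\<close>; rule Q;
        use m' regs in auto)
qed

text \<open>The potential \<open>28 * (D + 1) * card K\<close> loses at most one vertex's share,
  which is absorbed into the constant 150 together with the removal and the scan.\<close>

lemma run_delete_edge:
  assumes A: "A \<subseteq> S" "sym A" "irrefl A" "(u, v) \<in> A"
    and s: "represents A K s"
    and Q: "\<And>K' t s'. represents (A - {(u, v), (v, u)}) K' s' \<Longrightarrow>
      (\<forall>x<n. x \<notin> K' \<longrightarrow> (\<exists>w\<in>K'. (x, w) \<notin> A - {(u, v), (v, u)})) \<Longrightarrow> set (out s') = K' \<Longrightarrow>
      t + 28 * (D + 1) * card K \<le> 150 * (D + 1) + 28 * (D + 1) * card K' \<Longrightarrow> Q t s'"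
  shows "run W delete_edge (deletion_state (u, v) s) Q"
proof -
  let ?A = "A - {(u, v), (v, u)}" and ?s = "deletion_state (u, v) s"
  have vu: "(v, u) \<in> A" using A by (auto dest: symD)
  have uv: "u < n" "v < n" "u \<noteq> v" using A S by (auto simp: irrefl_def)
  have K: "K \<subseteq> {..<n}" "pairwise (\<lambda>u v. (u, v) \<in> A) K"
    and regs: "regs s 2 = n" "regs s 3 = card K" "regs s 4 \<in> K" "regs s 5 = 1" "regs s 6 = 0"
    and m: "stores n A L d (cnt A K) K (mem s)"
    using s by (auto simp: represents_def)
  have fin: "finite K" and card: "card K \<le> n"
    using finite_subset[OF K(1)] card_mono[OF _ K(1)] by auto
  have A': "?A \<subseteq> S" "sym ?A" "irrefl ?A" using A(1,3) symD[OF A(2)]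
    by (auto simp: irrefl_def intro!: symI)
  \<comment> \<open>The scan takes 26 of the 150 units, leaving 124 for everything that precedes
    it.\<close>
  have run_rest: "run W extend_clique s' (\<lambda>t'. Q (t + t'))"
    if "represents ?A K' s'" "out s' = []"
      "t + 28 * (D + 1) * card K \<le> 124 * (D + 1) + 28 * (D + 1) * card K'" for K' s' t
  proof (rule run_extend_clique[OF A' that(1,2)])
    fix K'' t' s''
    assume *: "represents ?A K'' s''" "K' \<subseteq> K''" "\<forall>x<n. x \<notin> K'' \<longrightarrow> (\<exists>w\<in>K''. (x, w) \<notin> ?A)"
      "set (out s'') = K''"
      "t' + 28 * (D + 1) * card K' \<le> 26 * (D + 1) + 28 * (D + 1) * card K''"
    show "Q (t + t') s''" by (rule Q[OF *(1,3,4)]) (use that(3) *(5) in linarith)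
  qed
  have "run W unlink ?s (\<lambda>t s'. run W (If_Nonzero 13
       (Seq (Bin_Op 4 Add 0 6) (Seq (Bin_Op 8 Add 1 6) (toggle Sub))) Skip) s'
      (\<lambda>t' s''. run W extend_clique s'' (\<lambda>t''. Q (t + (t' + t'')))))"
  proof (rule run_unlink[OF A(4) vu A(3,1) _ K(1)])
    fix t :: nat and s' :: state
    assume m': "stores n ?A L d (cnt ?A K) K (mem s')"
      and r': "\<forall>x. x \<notin> {7, 12, 13, 14} \<longrightarrow> regs s' x = regs ?s x"
        "regs s' 13 = of_bool (u \<in> K \<and> v \<in> K)"
      and out: "out s' = out ?s" and t: "t = 51"
    have regs': "regs s' 0 = u" "regs s' 1 = v" "regs s' 2 = n" "regs s' 3 = card K"
      "regs s' 4 \<in> K" "regs s' 5 = 1" "regs s' 6 = 0" "out s' = []"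
      using r' regs out by (auto simp: deletion_state_def)
    show "run W (If_Nonzero 13
       (Seq (Bin_Op 4 Add 0 6) (Seq (Bin_Op 8 Add 1 6) (toggle Sub))) Skip) s'
      (\<lambda>t' s''. run W extend_clique s'' (\<lambda>t''. Q (t + (t' + t''))))"
    proof (cases "u \<in> K \<and> v \<in> K")
      case True
      have c: "(\<lambda>x. apply_binop Sub (cnt ?A K x) (of_bool ((v, x) \<in> ?A))) = cnt ?A (K - {v})"
      proof
        fix x
        have "(v, x) \<in> ?A \<longleftrightarrow> (x, v) \<in> ?A" using A'(2) by (blast dest: symD)
        then show "apply_binop Sub (cnt ?A K x) (of_bool ((v, x) \<in> ?A)) = cnt ?A (K - {v}) x"
          using cnt_remove[OF fin, of v ?A x] True by simp
      qed
      have cardK: "card K = Suc (card (K - {v}))" using True fin by (metis card_Suc_Diff1)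
      let ?s' = "s'\<lparr>regs := (regs s')(4 := u, 8 := v)\<rparr>"
      have "run W (toggle Sub) ?s' (\<lambda>t' s''. run W extend_clique s'' (\<lambda>t''. Q ((54 + t') + t'')))"
      proof (rule run_toggle[OF _ A'(1) uv(2), of _ _ _ _ "K - {v}"])
        show "stores n ?A L d (cnt ?A K) K (mem ?s')" using m' by simp
        show "cnt ?A K x \<le> n" for x using cnt_le[OF fin, of ?A x] card by linarith
      next
        fix t' and s'' :: state
        assume m'': "stores n ?A L d (\<lambda>x. apply_binop Sub (cnt ?A K x) (of_bool ((v, x) \<in> ?A)))
            (K - {v}) (mem s'')"
          and r'': "\<forall>x. x \<notin> {3, 7, 9, 10, 11, 12, 13, 14} \<longrightarrow> regs s'' x = regs ?s' x"
            "regs s'' 3 = apply_binop Sub (regs ?s' 3) 1"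
          and out'': "out s'' = out ?s'" "t' \<le> 28 * (D + 1)"
        have "pairwise (\<lambda>u v. (u, v) \<in> ?A) (K - {v})" using K(2) by (auto simp: pairwise_def)
        then have rep: "represents ?A (K - {v}) s''"
          unfolding represents_def
        proof (intro conjI)
          show "stores n ?A L d (cnt ?A (K - {v})) (K - {v}) (mem s'')" using m'' unfolding c .
          show "regs s'' 3 = card (K - {v})" using r''(2) regs'(4) True fin by simp
          show "regs s'' 4 \<in> K - {v}" using r''(1) True uv(3) by simp
        qed (use r''(1) regs' K(1) in auto)
        show "run W extend_clique s'' (\<lambda>t''. Q ((54 + t') + t''))"
        proof (rule run_rest[OF rep])
          \<comment> \<open>Removing \<open>v\<close> costs up to \<open>28 * (D + 1)\<close>, and
            the smaller clique accounts for the same amount once more.\<close>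
          show "54 + t' + 28 * (D + 1) * card K \<le> 124 * (D + 1) + 28 * (D + 1) * card (K - {v})"
            using out''(2) cardK by simp
        qed (use out'' regs' in auto)
      qed (use regs' True card in auto)
      then show ?thesis
        using True r' regs' uv W t by (simp add: algebra_simps)
    next
      case False
      have "run W extend_clique s' (\<lambda>t''. Q (53 + t''))"
      proof (rule run_rest)
        show "represents ?A K s'"
          using m' regs' K False by (auto simp: represents_def pairwise_def)
      qed (use regs' in auto)
      then show ?thesis using False r' t by simp
    qed
  qed (use m regs in \<open>auto simp: deletion_state_def\<close>)
  then show ?thesis unfolding delete_edge_def by simp
qed

end

section \<open>Building the neighbour lists\<close>

lemma run_link:
  assumes "word_size n W" and S: "S \<subseteq> {..<n} \<times> {..<n}"
    and L: "\<forall>w<n. bij_betw (L w) {..<d w} (S `` {w})"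
    and m: "stores n S L d c K (mem s)"
    and regs: "regs s a = u" "regs s b = v" "regs s 2 = n" "regs s 5 = 1" "regs s 6 = 0"
    and ab: "a \<notin> {7, 13}" "b \<notin> {7, 13}" and uv: "u < n" "v < n" "(u, v) \<notin> S"
    and Q: "\<And>L' d' t s'. \<forall>w<n. bij_betw (L' w) {..<d' w} (insert (u, v) S `` {w}) \<Longrightarrow>
      stores n (insert (u, v) S) L' d' c K (mem s') \<Longrightarrow>
      (\<forall>x. x \<notin> {7, 13} \<longrightarrow> regs s' x = regs s x) \<Longrightarrow> out s' = out s \<Longrightarrow>
      (\<forall>x<n * n. mem s' x = mem s x) \<Longrightarrow> t = 25 \<Longrightarrow> Q t s'"
  shows "run W (link a b) s Q"
proof -
  interpret word_size n W by fact
  let ?L = "L(u := (L u)(d u := v))" and ?d = "d(u := Suc (d u))"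
  have fin: "finite (S `` {u})" using S by (auto intro: finite_subset[of _ "{..<n}"])
  have d: "d u = card (S `` {u})" using bij_betw_same_card[OF L[rule_format, OF uv(1)]] by simp
  \<comment> \<open>As \<open>v\<close> is not yet a neighbour of \<open>u\<close>, the row of
    \<open>u\<close> still has a free cell.\<close>
  have "Suc (d u) = card (insert v (S `` {u}))" using d fin uv(3) by simp
  also have "\<dots> \<le> card {..<n}" by (rule card_mono) (use S uv in auto)
  finally have du: "d u < n" by simp
  have image: "insert (u, v) S `` {w} = (if w = u then insert v (S `` {u}) else S `` {w})" for w
    by auto
  have "bij_betw (?L u) {..<d u} (S `` {u})"
    using L[rule_format, OF uv(1)] by (rule iffD1[OF bij_betw_cong, rotated]) simp
  then have "bij_betw (?L u) (insert (d u) {..<d u}) (insert v (S `` {u}))"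
    using uv(3) notIn_Un_bij_betw[of "d u" "{..<d u}" "?L u" "S `` {u}"] by simp
  then have L': "\<forall>w<n. bij_betw (?L w) {..<?d w} (insert (u, v) S `` {w})"
    using L by (simp add: lessThan_Suc image)
  have "stores n S ?L d c K ((mem s)(addr n 2 u (d u) := v))"
    by (rule stores_put(3)[OF m uv(1) du refl])
  then have "stores n S ?L ?d c K ((mem s)(addr n 2 u (d u) := v, addr n 3 u 0 := Suc (d u)))"
    using uv(1) by (rule stores_put(4)) simp
  then have m': "stores n (insert (u, v) S) ?L ?d c K
      ((mem s)(addr n 2 u (d u) := v, addr n 3 u 0 := Suc (d u), addr n 6 u v := Suc 0))"
    using uv(1,2) by (rule stores_put(1)) simp
  \<comment> \<open>The input must survive, because later edges are still to be read from
    it.\<close>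
  have low: "x \<noteq> addr n 2 u (d u)" "x \<noteq> addr n 3 u 0" "x \<noteq> addr n 6 u v" if "x < n * n" for x
    using that addr_ge[of 2 n u "d u"] addr_ge[of 3 n u 0] addr_ge[of 6 n u v] by auto
  have "Suc (d u) < W" using du W by linarith
  then show ?thesis
    unfolding link_def using uv regs ab du
    by (simp add: stores_get[OF m]) (rule Q[where L' = ?L and d' = ?d, OF L'], use m' low in auto)
qed

section \<open>Graphs as symmetric relations\<close>

definition arcs :: "nat set set \<Rightarrow> (nat \<times> nat) set" where
  "arcs E = {(u, v). {u, v} \<in> E}"

lemma arcs_empty [simp]: "arcs {} = {}"
  by (simp add: arcs_def)

lemma arcs_insert: "arcs (insert {u, v} E) = insert (v, u) (insert (u, v) (arcs E))"
  by (auto simp: arcs_def doubleton_eq_iff)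

lemma arcs_remove: "arcs (E - {{u, v}}) = arcs E - {(u, v), (v, u)}"
  by (auto simp: arcs_def doubleton_eq_iff)

lemma arcs_mono: "E \<subseteq> F \<Longrightarrow> arcs E \<subseteq> arcs F"
  by (auto simp: arcs_def)

lemma sym_arcs: "sym (arcs E)"
  by (auto simp: arcs_def sym_def insert_commute)

lemma simple_graph_mono: "simple_graph V E \<Longrightarrow> F \<subseteq> E \<Longrightarrow> simple_graph V F"
  by (auto simp: simple_graph_def)

lemma simple_graph_edge:
  assumes "simple_graph V E" "{u, v} \<in> E"
  shows "u \<in> V" "v \<in> V" "u \<noteq> v"
proof -
  obtain x y where "x \<in> V" "y \<in> V" "x \<noteq> y" "{u, v} = {x, y}"
    using assms unfolding simple_graph_def by blast
  then show "u \<in> V" "v \<in> V" "u \<noteq> v" by (auto simp: doubleton_eq_iff)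
qed

lemma irrefl_arcs: "simple_graph V E \<Longrightarrow> irrefl (arcs E)"
  by (auto simp: irrefl_def arcs_def dest: simple_graph_edge(3)[of _ _ x x for x])

lemma arcs_subset: "simple_graph V E \<Longrightarrow> arcs E \<subseteq> V \<times> V"
  by (auto simp: arcs_def dest: simple_graph_edge)

lemma degree_arcs:
  assumes "simple_graph V E"
  shows "card (arcs E `` {u}) = degree E u"
proof -
  have "bij_betw (\<lambda>v. {u, v}) (arcs E `` {u}) {e \<in> E. u \<in> e}"
    unfolding bij_betw_def
  proof
    show "inj_on (\<lambda>v. {u, v}) (arcs E `` {u})" by (auto simp: inj_on_def doubleton_eq_iff)
    show "(\<lambda>v. {u, v}) ` (arcs E `` {u}) = {e \<in> E. u \<in> e}"
    proof
      show "{e \<in> E. u \<in> e} \<subseteq> (\<lambda>v. {u, v}) ` (arcs E `` {u})"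
      proof
        fix e assume e: "e \<in> {e \<in> E. u \<in> e}"
        then obtain x y where "e = {x, y}" using assms by (auto simp: simple_graph_def)
        then obtain v where "e = {u, v}" using e by auto
        then show "e \<in> (\<lambda>v. {u, v}) ` (arcs E `` {u})" using e by (auto simp: arcs_def)
      qed
    qed (auto simp: arcs_def)
  qed
  then show ?thesis unfolding degree_def by (rule bij_betw_same_card)
qed

lemma degree_le_max_degree: "finite V \<Longrightarrow> u \<in> V \<Longrightarrow> degree E u \<le> max_degree V E"
  unfolding max_degree_def by (intro Max_ge) auto

lemma simple_graph_finite_edges: "simple_graph V E \<Longrightarrow> finite E"
  by (rule finite_subset[of _ "Pow V"]) (auto simp: simple_graph_def)

text \<open>Ensures that the input, two cells per edge, lies below address \<open>n * n\<close> and
  so below all arrays in use.\<close>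

lemma card_edges_le:
  assumes "simple_graph {..<n} E"
  shows "2 * card E \<le> n * n"
proof -
  have "E \<subseteq> {e. e \<subseteq> {..<n} \<and> card e = 2}"
  proof
    fix e assume "e \<in> E"
    then obtain u v where "u < n" "v < n" "u \<noteq> v" "e = {u, v}"
      using assms unfolding simple_graph_def by blast
    then show "e \<in> {e. e \<subseteq> {..<n} \<and> card e = 2}" by simp
  qed
  then have "card E \<le> n choose 2"
    using card_mono[of "{e. e \<subseteq> {..<n} \<and> card e = 2}" E] n_subsets[of "{..<n}" 2] by simp
  then have "2 * card E \<le> n * (n - 1)" by (simp add: choose_two)
  also have "\<dots> \<le> n * n" by simp
  finally show ?thesis .
qed

lemma maximal_clique_arcsI:
  assumes "K \<subseteq> V" "pairwise (\<lambda>u v. (u, v) \<in> arcs E) K"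
    and "\<forall>x\<in>V. x \<notin> K \<longrightarrow> (\<exists>w\<in>K. (x, w) \<notin> arcs E)"
  shows "maximal_clique V E K"
proof -
  have "clique V E K" using assms(1,2) by (auto simp: clique_def pairwise_def arcs_def)
  moreover have "K' = K" if K': "clique V E K'" "K \<subseteq> K'" for K'
  proof (rule ccontr)
    assume "K' \<noteq> K"
    then obtain x where x: "x \<in> K'" "x \<notin> K" using K'(2) by auto
    then obtain w where "w \<in> K" "(x, w) \<notin> arcs E" using assms(3) K'(1) by (auto simp: clique_def)
    then have "w \<in> K'" "x \<noteq> w" "{x, w} \<notin> E" using x K'(2) by (auto simp: arcs_def)
    then show False using x(1) K'(1) by (simp add: clique_def)
  qed
  ultimately show ?thesis by (auto simp: maximal_clique_def)
qed

section \<open>Complete runs\<close>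

lemma word_size_power: "word_size n ((n + 2) ^ 4)"
  by unfold_locales (simp add: eval_nat_numeral algebra_simps)

text \<open>The 57 units per edge are 4 for reading it, twice 25 for \<open>link\<close>, and 3 for
  the loop.\<close>

lemma run_build_lists:
  assumes G: "simple_graph {..<n} E" and es: "lists_edges es E" and "word_size n W"
    and s: "regs s 1 = length es" "regs s 2 = n" "regs s 5 = 1" "regs s 6 = 0"
      "mem s = mem (input_state n es)"
    and Q: "\<And>L d t s'. \<forall>w<n. bij_betw (L w) {..<d w} (arcs E `` {w}) \<Longrightarrow>
      stores n (arcs E) L d (\<lambda>_. 0) {} (mem s') \<Longrightarrow>
      (\<forall>x. x \<notin> {7, 13, 14, 15, 17, 18, 19} \<longrightarrow> regs s' x = regs s x) \<Longrightarrow> out s' = out s \<Longrightarrow>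
      t = 57 * length es + 3 \<Longrightarrow> Q t s'"
  shows "run W (for_loop 15 1 17
         (Seq (Bin_Op 14 Add 15 15) (Seq (Load 18 14) (Seq (Bin_Op 14 Add 14 5) (Seq (Load 19 14)
           (Seq (link 18 19) (link 19 18))))))) s Q"
proof -
  interpret word_size n W by fact
  let ?e = "\<lambda>(u, v). {u, v}"
  define F where "F i = set (map ?e (take i es))" for i
  let ?I = "\<lambda>i t (s' :: state). \<exists>L d. (\<forall>w<n. bij_betw (L w) {..<d w} (arcs (F i) `` {w})) \<and>
    stores n (arcs (F i)) L d (\<lambda>_. 0) {} (mem s') \<and>
    (\<forall>x<n * n. mem s' x = mem s x) \<and>
    (\<forall>x. x \<notin> {7, 13, 14, 15, 17, 18, 19} \<longrightarrow> regs s' x = regs s x) \<and> out s' = out s \<and> t = 57 * i"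
  have E: "E = set (map ?e es)" "distinct (map ?e es)" using es by (auto simp: lists_edges_def)
  have len: "2 * length es \<le> n * n"
    using card_edges_le[OF G] distinct_card[OF E(2)] E(1) by simp
  have small: "length es + 1 < W" using len W by (simp add: algebra_simps)
  show ?thesis
  proof (rule run_for_loop[where I = ?I and N = "length es"])
    \<comment> \<open>Memory beyond the input is zero, which already encodes empty lists, an empty
      matrix and an empty clique.\<close>
    have "mem s (addr n j u v) = 0" if "1 \<le> j" for j u v
      using s(5) addr_ge[OF that, of n u v] len by (simp add: input_state_def)
    then show "?I 0 0 s"
      by (intro exI[of _ "\<lambda>_ _. 0"] exI[of _ "\<lambda>_. 0"])
        (simp add: F_def stores_def bij_betw_def)
  next
    fix i t s'
    assume i: "i < length es" and I: "?I i t s'" and r: "regs s' 15 = i" "regs s' 1 = length es"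
    obtain L d where Ld: "\<forall>w<n. bij_betw (L w) {..<d w} (arcs (F i) `` {w})"
      and m: "stores n (arcs (F i)) L d (\<lambda>_. 0) {} (mem s')"
      and low: "\<forall>x<n * n. mem s' x = mem s x"
      and regs: "\<forall>x. x \<notin> {7, 13, 14, 15, 17, 18, 19} \<longrightarrow> regs s' x = regs s x"
      and out: "out s' = out s" and t: "t = 57 * i"
      using I by blast
    obtain u v where uv: "es ! i = (u, v)" by force
    have "{u, v} \<in> E" using nth_mem[OF i] uv E(1) by force
    then have uvn: "u < n" "v < n" "u \<noteq> v" using simple_graph_edge[OF G] by auto
    \<comment> \<open>Since each edge is listed once, the next one is new, and no neighbour enters a
      list twice.\<close>
    have "distinct (map ?e (take (Suc i) es))" using E(2) by (metis distinct_take take_map)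
    then have new: "{u, v} \<notin> F i" "F i \<subseteq> E"
      using i uv E(1) by (auto simp: take_Suc_conv_app_nth F_def dest: in_set_takeD)
    have FSuc: "arcs (F (Suc i)) = insert (v, u) (insert (u, v) (arcs (F i)))"
      using i uv arcs_insert[of u v "F i"] by (simp add: F_def take_Suc_conv_app_nth insert_commute)
    have sub: "arcs (F i) \<subseteq> {..<n} \<times> {..<n}"
      using arcs_subset[OF simple_graph_mono[OF G new(2)]] .
    have uvF: "(u, v) \<notin> arcs (F i)" "(v, u) \<notin> insert (u, v) (arcs (F i))"
      using new(1) uvn by (auto simp: arcs_def insert_commute)
    have ld: "mem s' (2 * i) = u" "mem s' (Suc (2 * i)) = v"
      using low len i uv s(5) by (auto simp: input_state_def)
    define R where "R t' s'' \<longleftrightarrow> ?I (Suc i) (t + t' + 3) s'' \<and>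
      regs s'' 15 = i \<and> regs s'' 1 = length es \<and> regs s'' 5 = 1" for t' s''
    let ?s = "s'\<lparr>regs := (regs s')(18 := u, 14 := Suc (2 * i), 19 := v)\<rparr>"
    have "run W (link 18 19) ?s (\<lambda>t1 s1. run W (link 19 18) s1 (\<lambda>t2. R (Suc (Suc (Suc (Suc (t1 + t2)))))))"
    proof (rule run_link[OF assms(3) sub Ld])
      fix L1 d1 and t1 :: nat and s1 :: state
      assume Ld1: "\<forall>w<n. bij_betw (L1 w) {..<d1 w} (insert (u, v) (arcs (F i)) `` {w})"
        and m1: "stores n (insert (u, v) (arcs (F i))) L1 d1 (\<lambda>_. 0) {} (mem s1)"
        and regs1: "\<forall>x. x \<notin> {7, 13} \<longrightarrow> regs s1 x = regs ?s x"
        and out1: "out s1 = out ?s" and low1: "\<forall>x<n * n. mem s1 x = mem ?s x" and t1: "t1 = 25"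
      show "run W (link 19 18) s1 (\<lambda>t2. R (Suc (Suc (Suc (Suc (t1 + t2))))))"
      proof (rule run_link[OF assms(3) _ Ld1 m1])
        fix L2 d2 and t2 :: nat and s2 :: state
        assume Ld2: "\<forall>w<n. bij_betw (L2 w) {..<d2 w} (insert (v, u) (insert (u, v) (arcs (F i))) `` {w})"
          and m2: "stores n (insert (v, u) (insert (u, v) (arcs (F i)))) L2 d2 (\<lambda>_. 0) {} (mem s2)"
          and regs2: "\<forall>x. x \<notin> {7, 13} \<longrightarrow> regs s2 x = regs s1 x"
          and out2: "out s2 = out s1" and low2: "\<forall>x<n * n. mem s2 x = mem s1 x" and t2: "t2 = 25"
        have "?I (Suc i) (t + (Suc (Suc (Suc (Suc (t1 + t2))))) + 3) s2"
        proof (intro exI conjI)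
          show "\<forall>w<n. bij_betw (L2 w) {..<d2 w} (arcs (F (Suc i)) `` {w})"
            "stores n (arcs (F (Suc i))) L2 d2 (\<lambda>_. 0) {} (mem s2)"
            using Ld2 m2 unfolding FSuc by blast+
          show "\<forall>x<n * n. mem s2 x = mem s x" using low low1 low2 by simp
          show "\<forall>x. x \<notin> {7, 13, 14, 15, 17, 18, 19} \<longrightarrow> regs s2 x = regs s x"
            using regs regs1 regs2 by simp
        qed (use out out1 out2 t t1 t2 in simp_all)
        moreover have "regs s2 15 = i" "regs s2 1 = length es" "regs s2 5 = 1"
          using regs2 regs1 r regs s by simp_all
        ultimately show "R (Suc (Suc (Suc (Suc (t1 + t2))))) s2" unfolding R_def by blast
      qed (use sub uvn uvF regs1 regs s in simp_all)
    qed (use m uvn uvF regs s in simp_all)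
    moreover have "Suc (2 * i) < W" using i len W by (simp add: algebra_simps)
    ultimately have "run W (Seq (Bin_Op 14 Add 15 15) (Seq (Load 18 14) (Seq (Bin_Op 14 Add 14 5)
        (Seq (Load 19 14) (Seq (link 18 19) (link 19 18)))))) s' R"
      using r regs s ld by (simp add: mult_2[symmetric])
    then show "run W (Seq (Bin_Op 14 Add 15 15) (Seq (Load 18 14) (Seq (Bin_Op 14 Add 14 5)
        (Seq (Load 19 14) (Seq (link 18 19) (link 19 18)))))) s' (\<lambda>t' s''. ?I (Suc i) (t + t' + 3) s'' \<and>
          regs s'' 15 = i \<and> regs s'' 1 = length es \<and> regs s'' 5 = 1)"
      unfolding R_def .
  next
    fix t s' assume "?I (length es) t s'"
    then show "Q (t + 3) s'" using E(1) by (auto simp: F_def intro: Q)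
  qed (use s small in auto)
qed

text \<open>The term with \<open>card K\<close> stands for insertions not yet compensated by
  removals, and the extra 1 in \<open>k + 1\<close> pays for the first scan. The lists belong to the
  arcs of the initial \<open>E\<close>, while \<open>represents\<close> refers to the current
  \<open>F\<close>.\<close>

definition run_invariant ::
  "nat \<Rightarrow> nat set set \<Rightarrow> nat \<Rightarrow> nat set set \<Rightarrow> state \<Rightarrow> nat set \<Rightarrow> nat \<Rightarrow> bool" where
  "run_invariant n E k F s K T \<longleftrightarrow> F \<subseteq> E \<and> card F + k = card E \<and>
     (\<forall>x<n. x \<notin> K \<longrightarrow> (\<exists>w\<in>K. (x, w) \<notin> arcs F)) \<and>
     T \<le> 57 * card E + 150 * (max_degree {..<n} E + 1) * (k + 1) +
       28 * (max_degree {..<n} E + 1) * card K \<and>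
     (\<exists>L d. neighbour_lists n ((n + 2) ^ 4) (arcs E) L d (max_degree {..<n} E) \<and>
       neighbour_lists.represents n L d (arcs F) K s)"

lemma run_initialize:
  assumes G: "simple_graph {..<n} E" and es: "lists_edges es E" and n: "n > 0"
  shows "run ((n + 2) ^ 4) initialize (input_state n es)
    (\<lambda>t s. run_invariant n E 0 E s (set (out s)) t)"
proof -
  let ?W = "(n + 2) ^ 4" and ?D = "max_degree {..<n} E" and ?s = "input_state n es"
  interpret word_size n ?W by (rule word_size_power)
  have card: "card E = length es" using es distinct_card by (fastforce simp: lists_edges_def)
  define R where "R t s \<longleftrightarrow> run_invariant n E 0 E s (set (out s)) t" for t s
  let ?s1 = "?s\<lparr>regs := (regs ?s)(2 := n, 5 := 1)\<rparr>"
  have "run ?W (for_loop 15 1 17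
         (Seq (Bin_Op 14 Add 15 15) (Seq (Load 18 14) (Seq (Bin_Op 14 Add 14 5) (Seq (Load 19 14)
           (Seq (link 18 19) (link 19 18))))))) ?s1
     (\<lambda>t s. run ?W (toggle Add) s (\<lambda>t' s'. run ?W extend_clique s' (\<lambda>t''. R (Suc (Suc (Suc (t + (t' + t''))))))))"
  proof (rule run_build_lists[OF G es word_size_power])
    fix L d and t :: nat and s :: state
    assume L: "\<forall>w<n. bij_betw (L w) {..<d w} (arcs E `` {w})"
      and m: "stores n (arcs E) L d (\<lambda>_. 0) {} (mem s)"
      and regs: "\<forall>x. x \<notin> {7, 13, 14, 15, 17, 18, 19} \<longrightarrow> regs s x = regs ?s1 x"
      and out: "out s = out ?s1" and t: "t = 57 * length es + 3"
    interpret neighbour_lists n ?W "arcs E" L d ?D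
    proof
      show "arcs E \<subseteq> {..<n} \<times> {..<n}" using arcs_subset[OF G] .
      show "d u \<le> ?D" if "u < n" for u
        using bij_betw_same_card[OF L[rule_format, OF that]] degree_arcs[OF G, of u]
          degree_le_max_degree[of "{..<n}" u E] that by simp
    qed (use L in blast)
    have r: "regs s 2 = n" "regs s 3 = 0" "regs s 4 = 0" "regs s 5 = 1" "regs s 6 = 0" "regs s 8 = 0"
      using regs by (simp_all add: input_state_def)
    have c: "(\<lambda>x. apply_binop Add 0 (of_bool ((0, x) \<in> arcs E))) = cnt (arcs E) {0}"
      using sym_arcs[of E] by (auto simp: cnt_def fun_eq_iff sym_def Int_insert_left)
    show "run ?W (toggle Add) s (\<lambda>t' s'. run ?W extend_clique s' (\<lambda>t''. R (Suc (Suc (Suc (t + (t' + t'')))))))"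
    proof (rule run_toggle[OF m order_refl n, where K' = "{0}"])
      fix t' and s' :: state
      assume m': "stores n (arcs E) L d (\<lambda>x. apply_binop Add 0 (of_bool ((0, x) \<in> arcs E))) {0} (mem s')"
        and regs': "\<forall>x. x \<notin> {3, 7, 9, 10, 11, 12, 13, 14} \<longrightarrow> regs s' x = regs s x"
        "regs s' 3 = apply_binop Add (regs s 3) 1"
        and out': "out s' = out s" and t': "t' \<le> 28 * (?D + 1)"
      show "run ?W extend_clique s' (\<lambda>t''. R (Suc (Suc (Suc (t + (t' + t''))))))"
      proof (rule run_extend_clique[OF order_refl sym_arcs irrefl_arcs[OF G]])
        show "represents (arcs E) {0} s'"
          unfolding represents_def
        proof (intro conjI)
          show "stores n (arcs E) L d (cnt (arcs E) {0}) {0} (mem s')" using m' unfolding c .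
        qed (use regs' r n in auto)
        show "out s' = []" using out out' by (simp add: input_state_def)
        fix K t'' s''
        assume K: "represents (arcs E) K s''" "\<forall>x<n. x \<notin> K \<longrightarrow> (\<exists>w\<in>K. (x, w) \<notin> arcs E)"
          "set (out s'') = K" and t'': "t'' + 28 * (?D + 1) * card {0 :: nat} \<le> 26 * (?D + 1) + 28 * (?D + 1) * card K"
        show "R (Suc (Suc (Suc (t + (t' + t''))))) s''"
          unfolding R_def run_invariant_def
        proof (intro conjI exI)
          show "neighbour_lists n ?W (arcs E) L d ?D" by unfold_locales
          show "represents (arcs E) (set (out s'')) s''" using K by simp
          show "Suc (Suc (Suc (t + (t' + t'')))) \<le> 57 * card E + 150 * (?D + 1) * (0 + 1) +
              28 * (?D + 1) * card (set (out s''))"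
            using t t' t'' K(3) card by simp
        qed (use K in auto)
      qed
    qed (use r in auto)
  qed (simp_all add: input_state_def)
  then show ?thesis
    unfolding initialize_def R_def[symmetric] using n word_size_power[of n]
    by (simp add: input_state_def word_size_def)
qed

lemma run_update:
  assumes G: "simple_graph {..<n} E" and I: "run_invariant n E k F s K T" and e: "{u, v} \<in> F"
  shows "run ((n + 2) ^ 4) delete_edge (deletion_state (u, v) s)
    (\<lambda>t s'. run_invariant n E (Suc k) (F - {{u, v}}) s' (set (out s')) (T + t))"
proof -
  let ?W = "(n + 2) ^ 4" and ?D = "max_degree {..<n} E"
  obtain L d where nl: "neighbour_lists n ?W (arcs E) L d ?D"
    and r: "neighbour_lists.represents n L d (arcs F) K s"
    and F: "F \<subseteq> E" "card F + k = card E"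
    and T: "T \<le> 57 * card E + 150 * (?D + 1) * (k + 1) + 28 * (?D + 1) * card K"
    using I unfolding run_invariant_def by blast
  interpret neighbour_lists n ?W "arcs E" L d ?D by (rule nl)
  show ?thesis
  proof (rule run_delete_edge[OF arcs_mono[OF F(1)] sym_arcs irrefl_arcs[OF simple_graph_mono[OF G F(1)]] _ r])
    show "(u, v) \<in> arcs F" using e by (simp add: arcs_def)
    fix K' t s'
    assume K': "represents (arcs F - {(u, v), (v, u)}) K' s'"
      "\<forall>x<n. x \<notin> K' \<longrightarrow> (\<exists>w\<in>K'. (x, w) \<notin> arcs F - {(u, v), (v, u)})" "set (out s') = K'"
      "t + 28 * (?D + 1) * card K \<le> 150 * (?D + 1) + 28 * (?D + 1) * card K'"
    have "finite F" using simple_graph_finite_edges[OF G] F(1) by (rule rev_finite_subset)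
    then have "card F = Suc (card (F - {{u, v}}))" using e by (rule card_Suc_Diff1[symmetric])
    then have "card (F - {{u, v}}) + Suc k = card E" using F(2) by simp
    moreover have "T + t \<le> 57 * card E + 150 * (?D + 1) * (Suc k + 1) + 28 * (?D + 1) * card K'"
      using K'(4) T by (simp add: algebra_simps)
    moreover have "F - {{u, v}} \<subseteq> E" using F(1) by blast
    ultimately show "run_invariant n E (Suc k) (F - {{u, v}}) s' (set (out s')) (T + t)"
      unfolding run_invariant_def arcs_remove K'(3) using K'(1,2) nl by blast
  qed
qed

text \<open>Of the adversary only one thing matters, that its choice is a current edge; this is what
  makes the bound hold for adaptive choices.\<close>

lemma reaches_invariant:
  assumes G: "simple_graph {..<n} E" and es: "lists_edges es E" and n: "n > 0"
    and r: "reaches ((n + 2) ^ 4) (initialize, delete_edge) adv n es k F s os T"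
  shows "run_invariant n E k F s (set (last os)) T"
  using r
proof induction
  case (init t s)
  then show ?case
    using run_exec[OF run_initialize[OF G es n]] es by (simp add: lists_edges_def)
next
  case (update k F s os T u v t s')
  then show ?case
    using run_exec[OF run_update[OF G update.IH update.hyps(3)]] by simp
qed

lemma run_invariant_clique:
  assumes "run_invariant n E k F s K T"
  shows "K \<subseteq> {..<n}" "pairwise (\<lambda>u v. (u, v) \<in> arcs F) K"
  using assms by (auto simp: run_invariant_def neighbour_lists.represents_def)

lemma maintains_maximal_clique_initialize_delete_edge:
  assumes G: "simple_graph {..<n} E" and es: "lists_edges es E"
  shows "maintains_maximal_clique ((n + 2) ^ 4) (initialize, delete_edge) adv n es"
proof (cases "n = 0")
  \<comment> \<open>Without vertices initialization does nothing, the empty output is the maximal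
    clique, and there is no edge to delete.\<close>
  case True
  then have E: "E = {}" "es = []" using G es by (auto simp: simple_graph_def lists_edges_def)
  have run: "run W initialize (input_state n es) (\<lambda>t s. out s = [])" for W
    using True E by (simp add: initialize_def input_state_def)
  have *: "F = {} \<and> set (last os) = {}"
    if "reaches W (initialize, delete_edge) adv n es k F s os T" for W k F s os T
    using that by induction (use run_exec[OF run] E in auto)
  have "\<exists>t s. exec ((n + 2) ^ 4) initialize (input_state n es) t s"
    using run unfolding run_def by blast
  then have "always_halts ((n + 2) ^ 4) (initialize, delete_edge) adv n es"
    unfolding always_halts_def by (auto dest!: *)
  moreover have "maximal_clique {..<n} {} {}"
    using True by (auto simp: maximal_clique_def clique_def)
  ultimately show ?thesis
    unfolding maintains_maximal_clique_def by (auto dest!: *)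
next
  case False
  then have n: "n > 0" by simp
  note inv = reaches_invariant[OF G es n]
  have "always_halts ((n + 2) ^ 4) (initialize, delete_edge) adv n es"
    unfolding always_halts_def fst_conv snd_conv
  proof (intro conjI allI impI)
    show "\<exists>t s. exec ((n + 2) ^ 4) initialize (input_state n es) t s"
      using run_initialize[OF G es n] unfolding run_def by blast
    show "\<exists>t s'. exec ((n + 2) ^ 4) delete_edge (deletion_state (u, v) s) t s'"
      if "reaches ((n + 2) ^ 4) (initialize, delete_edge) adv n es k F s os T \<and>
        adv os = (u, v) \<and> {u, v} \<in> F" for k F s os T u v
      using run_update[OF G inv] that unfolding run_def by blast
  qed
  moreover have "maximal_clique {..<n} F (set (last os))"
    if "reaches ((n + 2) ^ 4) (initialize, delete_edge) adv n es k F s os T" for k F s os T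
    using inv[OF that] run_invariant_clique[OF inv[OF that]]
    by (intro maximal_clique_arcsI) (auto simp: run_invariant_def)
  ultimately show ?thesis unfolding maintains_maximal_clique_def by blast
qed

text \<open>With no edge left the clique has at most one vertex, and \<open>k\<close> equals the
  number of initial edges. From \<open>?D + 1 \<le> 2 * ?D\<close> and
  \<open>k + 1 \<le> 2 * k\<close> the constant is 57 + 150 * 4 + 28 * 2 = 713.\<close>

lemma amortized_update_time_initialize_delete_edge:
  assumes G: "simple_graph {..<n} E" and es: "lists_edges es E"
  shows "amortized_update_time_le ((n + 2) ^ 4) (initialize, delete_edge) adv n es
    (713 * real (max_degree {..<n} E))"
  unfolding amortized_update_time_le_def
proof (intro allI impI, elim conjE)
  fix k s os T
  let ?D = "max_degree {..<n} E"
  assume r: "reaches ((n + 2) ^ 4) (initialize, delete_edge) adv n es k {} s os T" and k: "k > 0"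
  have "n > 0"
  proof (rule ccontr)
    assume "\<not> n > 0"
    then have "es = []" using G es by (auto simp: simple_graph_def lists_edges_def)
    have "F = {} \<and> k = 0" if "reaches ((n + 2) ^ 4) (initialize, delete_edge) adv n es k F s os T"
      for k F s os T
      using that by induction (use \<open>es = []\<close> in auto)
    with r k show False by blast
  qed
  then have I: "run_invariant n E k {} s (set (last os)) T" by (rule reaches_invariant[OF G es _ r])
  have m: "card E = k" using I by (simp add: run_invariant_def)
  have T: "T \<le> 57 * card E + 150 * (?D + 1) * (k + 1) + 28 * (?D + 1) * card (set (last os))"
    using I unfolding run_invariant_def by blast
  have "card (set (last os)) \<le> 1"
    using run_invariant_clique(2)[OF I] by (simp add: card_le_Suc0_iff_eq pairwise_def)
  then have K: "28 * (?D + 1) * card (set (last os)) \<le> 28 * (?D + 1)" by simp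
  \<comment> \<open>A positive number of deletions means an initial edge, so the maximum degree is
    at least 1; this allows a bound proportional to it without an additive constant.\<close>
  have "E \<noteq> {}" using m k by auto
  then obtain u v where uv: "{u, v} \<in> E" using G by (fastforce simp: simple_graph_def)
  have "finite E" using simple_graph_finite_edges[OF G] .
  then have "degree E u > 0" using uv by (auto simp: degree_def card_gt_0_iff)
  moreover have "degree E u \<le> ?D"
    using simple_graph_edge(1)[OF G uv] by (intro degree_le_max_degree) auto
  ultimately have D: "?D \<ge> 1" by simp
  have "T \<le> 57 * k + 150 * (?D + 1) * (k + 1) + 28 * (?D + 1)"
    using T K m by linarith
  also have "\<dots> = 57 * k + 150 * ((?D + 1) * (k + 1)) + 28 * (?D + 1)"
    by (simp only: mult.assoc)
  also have "\<dots> \<le> 57 * (?D * k) + 150 * ((2 * ?D) * (2 * k)) + 28 * (2 * (?D * k))"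
  proof (intro add_mono mult_le_mono2)
    show "k \<le> ?D * k" using D by simp
    show "(?D + 1) * (k + 1) \<le> (2 * ?D) * (2 * k)" using D k by (intro mult_le_mono) auto
    have "?D \<le> ?D * k" using k by simp
    then show "?D + 1 \<le> 2 * (?D * k)" using D by linarith
  qed
  also have "\<dots> = 713 * ?D * k" by simp
  finally have "real T \<le> real (713 * ?D * k)" by (rule of_nat_mono)
  then show "real T / real k \<le> 713 * real ?D" using k by (simp add: divide_le_eq)
qed

theorem theorem5p3:
  shows "\<exists>(A :: dyn_algorithm) (c :: nat) (C :: real).
    \<forall>(n :: nat) (E :: nat set set) (es :: (nat \<times> nat) list) (adv :: adversary).
      simple_graph {..<n} E \<and> lists_edges es E \<longrightarrow>
        maintains_maximal_clique ((n + 2) ^ c) A adv n es \<and>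
        amortized_update_time_le ((n + 2) ^ c) A adv n es (C * real (max_degree {..<n} E))"
  using maintains_maximal_clique_initialize_delete_edge
    amortized_update_time_initialize_delete_edge by blast

end
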